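(* For every $y\in\mathcal{D}(T^+)$, the sequence of SINE iterates $\{x_n\}$ for the data $y$ converges to $T^+y$.
   Context: $T:\mathcal{X}\to\mathcal{Y}$ is a continuous linear operator between Hilbert spaces whose range $\mathcal{R}(T)$ is not closed. $T^+$ is its Moore--Penrose inverse, with domain $\mathcal{D}(T^+)=\mathcal{R}(T)\oplus\mathcal{R}(T)^\perp$: for $y\in\mathcal{D}(T^+)$, $T^+y$ is the unique element $x^+\in\mathcal{N}(T)^\perp$ with $T^*Tx^+=T^*y$. SINE (Shift-and-Invert on the Normal Equation) for the (unperturbed) data $y$: fix $\gamma>0$ and for $m\ge1$ let $$\mathcal{Q}_m=\mathrm{span}\{T^*y,(I+T^*T/\gamma)^{-1}T^*y,\ldots,(I+T^*T/\gamma)^{-m+1}T^*y\}.$$ The SINE iterates are $x_0=0$ and $x_m=\mathrm{argmin}_{x\in\mathcal{Q}_m}\|y-Tx\|$ for $m\ge 1$ (the minimiser is unique). *)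

theory Defs
  imports "HOL-Analysis.Analysis"
begin

text \<open>
  The Hilbert spaces may be real or complex.  The library has no complex inner product spaces, so
  the scalar field is a type of class \<open>real_or_complex\<close>.  Its instances are exactly the real and
  the complex numbers: expanding \<open>(1 + z) * conjug (1 + z)\<close> shows that \<open>z + conjug z\<close> is real,
  hence every \<open>z\<close> is a root of a real quadratic polynomial.
\<close>

class real_or_complex = real_normed_field +
  fixes conjug :: "'a \<Rightarrow> 'a"
  assumes conjug_add: "conjug (a + b) = conjug a + conjug b"
    and conjug_mult: "conjug (a * b) = conjug a * conjug b"
    and conjug_conjug: "conjug (conjug a) = a"
    and mult_conjug: "a * conjug a = (norm a)\<^sup>2 *\<^sub>R 1"

instantiation real :: real_or_complex
begin

definition conjug_real :: "real \<Rightarrow> real" where "conjug_real a = a"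

instance by standard (simp_all add: conjug_real_def power2_eq_square)

end

instantiation complex :: real_or_complex
begin

definition conjug_complex :: "complex \<Rightarrow> complex" where "conjug_complex = cnj"

instance by standard (simp_all add: conjug_complex_def complex_mult_cnj cmod_power2 scaleR_conv_of_real)

end

text \<open>
  A Hilbert space over \<open>'k\<close>, with inner product \<open>ip\<close> linear in the first argument.  The norm, the
  topology and completeness are those of the type.  The sort \<open>real_inner\<close> is no restriction to
  real spaces: a complex Hilbert space carries the real inner product given by the real part of
  \<open>ip\<close>, which induces the same norm.
\<close>

locale hilbert_space = vector_space scale
  for scale :: "'k::real_or_complex \<Rightarrow> 'x::{real_inner, complete_space} \<Rightarrow> 'x" +
  fixes ip :: "'x \<Rightarrow> 'x \<Rightarrow> 'k"
  assumes scale_of_real: "scale (of_real r) x = r *\<^sub>R x"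
    and ip_add_left: "ip (x + x') z = ip x z + ip x' z"
    and ip_scale_left: "ip (scale a x) z = a * ip x z"
    and ip_conjug: "ip z x = conjug (ip x z)"
    and ip_self: "ip x x = of_real ((norm x)\<^sup>2)"

lemma hilbert_space_real:
  "hilbert_space scaleR (inner :: 'x::{real_inner, complete_space} \<Rightarrow> 'x \<Rightarrow> real)"
  by unfold_locales
    (simp_all add: algebra_simps conjug_real_def inner_commute power2_norm_eq_inner)

lemma hilbert_space_complex: "hilbert_space (*) (\<lambda>x z. x * cnj z :: complex)"
  by unfold_locales
    (simp_all add: algebra_simps conjug_complex_def complex_mult_cnj cmod_power2 scaleR_conv_of_real)

definition orth_compl :: "('x \<Rightarrow> 'x \<Rightarrow> 'k::zero) \<Rightarrow> 'x set \<Rightarrow> 'x set" where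
  "orth_compl ip S = {x. \<forall>z\<in>S. ip x z = 0}"

definition hilbert_adjoint ::
    "('x \<Rightarrow> 'x \<Rightarrow> 'k) \<Rightarrow> ('y \<Rightarrow> 'y \<Rightarrow> 'k) \<Rightarrow> ('x \<Rightarrow> 'y) \<Rightarrow> 'y \<Rightarrow> 'x" where
  "hilbert_adjoint ipX ipY T = (THE S. \<forall>x y. ipY (T x) y = ipX x (S y))"

definition mp_domain ::
    "('y \<Rightarrow> 'y \<Rightarrow> 'k::zero) \<Rightarrow> ('x \<Rightarrow> 'y::plus) \<Rightarrow> 'y set" where
  "mp_domain ipY T = {u + v | u v. u \<in> range T \<and> v \<in> orth_compl ipY (range T)}"

definition mp_inverse ::
    "('x \<Rightarrow> 'x \<Rightarrow> 'k::zero) \<Rightarrow> ('y \<Rightarrow> 'y \<Rightarrow> 'k) \<Rightarrow> ('x \<Rightarrow> 'y::zero) \<Rightarrow> 'y \<Rightarrow> 'x" where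
  "mp_inverse ipX ipY T y =
     (THE x. x \<in> orth_compl ipX {z. T z = 0} \<and>
        hilbert_adjoint ipX ipY T (T x) = hilbert_adjoint ipX ipY T y)"

text \<open>
  For continuous linear \<open>T\<close> and \<open>\<gamma> > 0\<close> the map below is a bijection, so \<open>inv\<close> is its inverse.
\<close>

definition shift_invert ::
    "('x::real_vector \<Rightarrow> 'x \<Rightarrow> 'k) \<Rightarrow> ('y \<Rightarrow> 'y \<Rightarrow> 'k) \<Rightarrow> ('x \<Rightarrow> 'y) \<Rightarrow> real \<Rightarrow> 'x \<Rightarrow> 'x" where
  "shift_invert ipX ipY T \<gamma> =
     inv (\<lambda>x. x + (1 / \<gamma>) *\<^sub>R hilbert_adjoint ipX ipY T (T x))"

definition sine_space ::
    "('k::comm_ring_1 \<Rightarrow> 'x::real_vector \<Rightarrow> 'x) \<Rightarrow> ('x \<Rightarrow> 'x \<Rightarrow> 'k) \<Rightarrow> ('y \<Rightarrow> 'y \<Rightarrow> 'k) \<Rightarrow>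
     ('x \<Rightarrow> 'y) \<Rightarrow> real \<Rightarrow> 'y \<Rightarrow> nat \<Rightarrow> 'x set" where
  "sine_space scaleX ipX ipY T \<gamma> y m =
     module.span scaleX
       {(shift_invert ipX ipY T \<gamma> ^^ j) (hilbert_adjoint ipX ipY T y) | j. j < m}"

definition sine_iterate ::
    "('k::comm_ring_1 \<Rightarrow> 'x::real_vector \<Rightarrow> 'x) \<Rightarrow> ('x \<Rightarrow> 'x \<Rightarrow> 'k) \<Rightarrow> ('y \<Rightarrow> 'y \<Rightarrow> 'k) \<Rightarrow>
     ('x \<Rightarrow> 'y::real_normed_vector) \<Rightarrow> real \<Rightarrow> 'y \<Rightarrow> nat \<Rightarrow> 'x" where
  "sine_iterate scaleX ipX ipY T \<gamma> y m =
     (if m = 0 then 0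
      else (ARG_MIN (\<lambda>x. norm (y - T x)) x. x \<in> sine_space scaleX ipX ipY T \<gamma> y m))"

end

(*
  Write z = T^+ y, A = T* T, B = (I + A/gamma)^-1, C = A B.  In the inner product
  g(u,v) = <u,v> + <Tu,Tv>/gamma, equivalent to the original one, C is selfadjoint with
  g(C u, v) = <Tu,Tv>, and the errors e_m = z - x_m are those of the conjugate gradient iteration
  for C with initial error (I + A/gamma) z.  Unless some residual r_i = C e_i vanishes, in which
  case e_i = 0, the residuals form a g-orthogonal basis of the Krylov spaces.  Since
  g(e_m, r_i) = |T e_max(m,i)|^2 is nonnegative and decreasing in m, expanding in this basis gives
  g(e_m, e_k - e_m) >= 0 for k <= m, hence |e_k - e_m|^2 <= g(e_k,e_k) - g(e_m,e_m), and (e_m) is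
  Cauchy.  For its limit e, C e is both orthogonal to all Krylov spaces and a limit of elements of
  them, so C e = 0; as e is orthogonal to the kernel of T, e = 0.
*)
theory Submission
  imports Defs
begin

section \<open>Minimisation of quadratic functionals\<close>

lemma linear_term_zero_of_nonneg_quadratic:
  fixes b c :: real
  assumes "\<And>t. 0 \<le> t\<^sup>2 * c + 2 * t * b" and "0 \<le> c"
  shows "b = 0"
proof -
  \<comment> \<open>The quadratic is smallest at \<open>- b / c\<close>; enlarging the denominator
    by 1 also covers \<open>c = 0\<close> and still gives a negative value unless
    \<open>b = 0\<close>.\<close>
  have "0 \<le> (- b / (c + 1))\<^sup>2 * c + 2 * (- b / (c + 1)) * b"
    by (rule assms(1))
  also have "\<dots> = - (b\<^sup>2 * (c + 2)) / (c + 1)\<^sup>2"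
    using assms(2) by (simp add: divide_simps power2_eq_square) (simp add: algebra_simps)
  finally have "b\<^sup>2 * (c + 2) \<le> 0"
    using assms(2) by (simp add: divide_simps split: if_splits)
  then show ?thesis
    using assms(2) by (simp add: mult_le_0_iff)
qed

text \<open>
  The symmetric Lax--Milgram lemma, by minimising \<open>g u u - 2 * f u\<close> over \<open>U\<close>: the parallelogram
  law makes minimising sequences Cauchy.
\<close>

lemma coercive_form_represents:
  fixes g :: "'a::{real_inner, complete_space} \<Rightarrow> 'a \<Rightarrow> real"
  assumes g: "bounded_bilinear g" and sym: "\<And>u v. g u v = g v u"
    and coercive: "\<And>u. (norm u)\<^sup>2 \<le> g u u"
    and U: "subspace U" "closed U" and f: "bounded_linear f"
  obtains x where "x \<in> U" and "\<And>v. v \<in> U \<Longrightarrow> g x v = f v"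
proof -
  interpret g: bounded_bilinear g by (rule g)
  interpret f: bounded_linear f by (rule f)
  define J where "J u = g u u - 2 * f u" for u
  define m where "m = Inf (J ` U)"
  obtain M where M: "\<And>u. \<bar>f u\<bar> \<le> norm u * M"
    using f.bounded by auto
  \<comment> \<open>Coercivity lets the quadratic term absorb the linear one by completing the
    square with the bound \<open>M\<close> of \<open>f\<close>.\<close>
  have "- M\<^sup>2 \<le> J u" for u
  proof -
    have "0 \<le> (norm u - M)\<^sup>2" by simp
    also have "\<dots> = (norm u)\<^sup>2 - 2 * (norm u * M) + M\<^sup>2"
      by (simp add: power2_diff)
    finally show ?thesis
      using coercive[of u] M[of u] unfolding J_def by linarith
  qed
  then have bdd: "bdd_below (J ` U)" by (rule bdd_belowI2)
  have ne: "J ` U \<noteq> {}" using subspace_0[OF U(1)] by auto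
  have m_le: "m \<le> J u" if "u \<in> U" for u
    unfolding m_def using bdd that by (auto intro: cInf_lower)
  have "\<exists>u\<in>U. J u < m + 1 / real (Suc n)" for n
    using cInf_lessD[OF ne, of "m + 1 / real (Suc n)"] unfolding m_def by auto
  then obtain u where uU: "\<And>n. u n \<in> U" and u: "\<And>n. J (u n) < m + 1 / real (Suc n)"
    by metis
  have parallelogram: "(norm (a - b))\<^sup>2 \<le> 2 * (J a + J b - 2 * m)" if "a \<in> U" "b \<in> U" for a b
  proof -
    have "(1/2) *\<^sub>R (a + b) \<in> U"
      using that U(1) by (intro subspace_scale subspace_add)
    then have "m \<le> J ((1/2) *\<^sub>R (a + b))" by (rule m_le)
    also have "\<dots> = (J a + J b) / 2 - g (a - b) (a - b) / 4"
      by (simp add: J_def g.add_left g.add_right g.diff_left g.diff_right g.scaleR_left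
          g.scaleR_right f.add f.scale sym[of b a] field_simps)
    finally show ?thesis using coercive[of "a - b"] by (simp add: field_simps)
  qed
  have "Cauchy u"
  proof (rule CauchyI)
    fix e :: real assume "0 < e"
    \<comment> \<open>Two values of \<open>J\<close>, each within \<open>e\<^sup>2 / 4\<close> of
      \<open>m\<close>, have total excess below \<open>e\<^sup>2 / 2\<close>, and
      \<open>parallelogram\<close> doubles it.\<close>
    then obtain N where N: "1 / real (Suc N) < e\<^sup>2 / 4"
      using nat_approx_posE[of "e\<^sup>2 / 4"] by (metis divide_pos_pos zero_less_numeral zero_less_power)
    have "norm (u i - u j) < e" if "N \<le> i" "N \<le> j" for i j
    proof -
      have *: "J (u k) < m + e\<^sup>2 / 4" if "N \<le> k" for k
      proof -
        have "1 / real (Suc k) \<le> 1 / real (Suc N)" using that by (simp add: frac_le)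
        then show ?thesis using u[of k] N by linarith
      qed
      then have "2 * (J (u i) + J (u j) - 2 * m) < e\<^sup>2"
        using *[OF that(1)] *[OF that(2)] by (simp add: field_simps)
      then have "(norm (u i - u j))\<^sup>2 < e\<^sup>2"
        using parallelogram[OF uU uU, of i j] by linarith
      then show ?thesis using \<open>0 < e\<close> by (simp add: power_less_imp_less_base)
    qed
    then show "\<exists>N. \<forall>i\<ge>N. \<forall>j\<ge>N. norm (u i - u j) < e" by blast
  qed
  then obtain x where x: "u \<longlonglongrightarrow> x"
    using Cauchy_convergent convergent_def by blast
  have xU: "x \<in> U"
    using closed_sequentially[OF U(2)] uU x by blast
  have "(\<lambda>n. J (u n)) \<longlonglongrightarrow> J x"
    unfolding J_def by (intro tendsto_intros g.tendsto f.tendsto x)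
  moreover have "(\<lambda>n. m + 1 / real (Suc n)) \<longlonglongrightarrow> m + 0"
    by (intro tendsto_intros LIMSEQ_Suc[OF lim_1_over_n])
  ultimately have Jx: "J x \<le> m"
    using u by (intro LIMSEQ_le[of "\<lambda>n. J (u n)" _ "\<lambda>n. m + 1 / real (Suc n)"]) (auto intro: less_imp_le)
  \<comment> \<open>Along each line \<open>x + t *\<^sub>R v\<close> the increment of
    \<open>J\<close> is a nonnegative quadratic in \<open>t\<close>, so its linear coefficient
    vanishes.\<close>
  have "g x v - f v = 0" if v: "v \<in> U" for v
  proof (rule linear_term_zero_of_nonneg_quadratic[where c = "g v v"])
    fix t :: real
    have "x + t *\<^sub>R v \<in> U"
      using xU v U(1) by (intro subspace_scale subspace_add)
    then have "J x \<le> J (x + t *\<^sub>R v)"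
      using Jx m_le by fastforce
    then show "0 \<le> t\<^sup>2 * g v v + 2 * t * (g x v - f v)"
      by (simp add: J_def g.add_left g.add_right g.scaleR_left g.scaleR_right f.add f.scale
          sym[of v x] power2_eq_square algebra_simps)
  next
    show "0 \<le> g v v" using coercive[of v] zero_le_power2 order_trans by blast
  qed
  then show ?thesis using that xU by simp
qed

section \<open>Bounded operators, adjoints and least squares\<close>

lemma bounded_linear_if_continuous:
  fixes T :: "'a::real_normed_vector \<Rightarrow> 'b::real_normed_vector"
  assumes "linear T" and "continuous_on UNIV T"
  shows "bounded_linear T"
proof -
  interpret linear T by (rule assms(1))
  have "isCont T 0"
    using assms(2) by (simp add: continuous_on_eq_continuous_at)
  then obtain d where d: "0 < d" "\<And>x. norm x < d \<Longrightarrow> norm (T x) < 1"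
    unfolding continuous_at_eps_delta by (metis dist_0_norm diff_zero dist_norm zero zero_less_one)
  show ?thesis
  proof (rule bounded_linear_intro)
    show "T (x + y) = T x + T y" for x y by (rule add)
    show "T (r *\<^sub>R x) = r *\<^sub>R T x" for r x by (rule scale)
    show "norm (T x) \<le> norm x * (2 / d)" for x
    proof (cases "x = 0")
      case False
      define c where "c = d / (2 * norm x)"
      have "0 < c" using False d(1) by (simp add: c_def)
      have "norm (c *\<^sub>R x) < d" using False d(1) by (simp add: c_def)
      then have "norm (T (c *\<^sub>R x)) < 1" by (rule d(2))
      then have "c * norm (T x) < 1" using \<open>0 < c\<close> by (simp add: scale)
      then show ?thesis using False d(1) by (simp add: c_def field_simps)
    qed (simp add: zero)
  qed
qed

text \<open>Riesz representation, the case of \<open>inner\<close> itself in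
  \<open>coercive_form_represents\<close>, yields \<open>S y\<close> for each \<open>y\<close>;
  testing the adjoint identity with \<open>S y\<close> bounds \<open>S\<close>.\<close>

lemma bounded_linear_adjoint_exists:
  fixes T :: "'a::{real_inner, complete_space} \<Rightarrow> 'b::real_inner"
  assumes "bounded_linear T"
  obtains S where "bounded_linear S" and "\<And>x y. inner (T x) y = inner x (S y)"
proof -
  interpret T: bounded_linear T by (rule assms)
  have "\<exists>s. \<forall>x. inner s x = inner (T x) y" for y
  proof -
    have "bounded_linear (\<lambda>x. inner (T x) y)"
      by (rule bounded_linear_inner_left_comp[OF assms])
    then show ?thesis
      using coercive_form_represents[of inner UNIV "\<lambda>x. inner (T x) y"]
      by (metis bounded_bilinear_inner inner_commute power2_norm_eq_inner order_refl subspace_UNIV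
          closed_UNIV UNIV_I)
  qed
  then obtain S where S: "\<And>x y. inner (T x) y = inner x (S y)"
    by (metis inner_commute)
  obtain M where M: "\<And>x. norm (T x) \<le> norm x * M" "0 \<le> M"
    using T.nonneg_bounded by blast
  have "bounded_linear S"
  proof (rule bounded_linear_intro)
    show "S (x + y) = S x + S y" for x y
      by (rule vector_eq_ldot[THEN iffD1]) (simp add: inner_add_right flip: S)
    show "S (r *\<^sub>R x) = r *\<^sub>R S x" for r x
      by (rule vector_eq_ldot[THEN iffD1]) (simp flip: S)
    show "norm (S y) \<le> norm y * M" for y
    proof (cases "S y = 0")
      case False
      have "(norm (S y))\<^sup>2 = inner (T (S y)) y" by (simp add: S power2_norm_eq_inner)
      also have "\<dots> \<le> norm (T (S y)) * norm y" by (rule norm_cauchy_schwarz)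
      also have "\<dots> \<le> norm (S y) * M * norm y" by (intro mult_right_mono M) simp
      finally show ?thesis using False by (simp add: power2_eq_square mult_ac)
    qed (use M in simp)
  qed
  then show ?thesis using that S by blast
qed

text \<open>Pairing the image of \<open>u\<close> with \<open>v\<close> gives
  \<open>inner v u + inner (T v) (T u) / \<gamma>\<close>, a symmetric form dominating the squared
  norm. Definiteness gives injectivity, Lax--Milgram surjectivity.\<close>

lemma normal_shift_bij:
  fixes T :: "'a::{real_inner, complete_space} \<Rightarrow> 'b::real_inner"
  assumes T: "bounded_linear T" and adj: "\<And>x y. inner (T x) y = inner x (S y)" and "0 < \<gamma>"
  shows "bij (\<lambda>x. x + (1 / \<gamma>) *\<^sub>R S (T x))"
proof (rule bijI)
  let ?G = "\<lambda>x. x + (1 / \<gamma>) *\<^sub>R S (T x)"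
  interpret T: bounded_linear T by (rule T)
  have form: "inner v (?G u) = inner v u + inner (T v) (T u) / \<gamma>" for u v
    by (simp add: inner_add_right adj)
  show "inj ?G"
  proof (rule injI)
    fix u v assume eq: "?G u = ?G v"
    have "inner (u - v) (?G u - ?G v) = (norm (u - v))\<^sup>2 + (norm (T (u - v)))\<^sup>2 / \<gamma>"
      by (subst inner_diff_right, unfold form)
        (simp add: T.diff power2_norm_eq_inner inner_diff_right diff_divide_distrib)
    then have "(norm (u - v))\<^sup>2 + (norm (T (u - v)))\<^sup>2 / \<gamma> = 0" unfolding eq by simp
    moreover have "0 \<le> (norm (T (u - v)))\<^sup>2 / \<gamma>" using \<open>0 < \<gamma>\<close> by simp
    ultimately have "(norm (u - v))\<^sup>2 = 0" using zero_le_power2[of "norm (u - v)"] by linarith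
    then show "u = v" by simp
  qed
  show "surj ?G"
  proof (unfold surj_def, rule allI)
    fix w
    let ?g = "\<lambda>u v. inner u v + inner (T u) (T v) / \<gamma>"
    have "bounded_bilinear ?g"
    proof (unfold_locales, goal_cases)
      case 5
      obtain M where M: "\<And>x. norm (T x) \<le> norm x * M" "0 \<le> M"
        using T.nonneg_bounded by blast
      have "norm (?g u v) \<le> norm u * norm v * (1 + M * M / \<gamma>)" for u v
      proof -
        have "\<bar>inner (T u) (T v)\<bar> \<le> norm (T u) * norm (T v)" by (rule Cauchy_Schwarz_ineq2)
        also have "\<dots> \<le> (norm u * M) * (norm v * M)"
          using M by (intro mult_mono) auto
        finally have "\<bar>inner (T u) (T v) / \<gamma>\<bar> \<le> norm u * norm v * (M * M / \<gamma>)"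
          using \<open>0 < \<gamma>\<close> by (simp add: divide_right_mono mult_ac)
        then show ?thesis
          using Cauchy_Schwarz_ineq2[of u v] abs_triangle_ineq[of "inner u v" "inner (T u) (T v) / \<gamma>"]
          by (simp add: distrib_left)
      qed
      then show ?case by blast
    qed (simp_all add: T.add T.scale inner_add_left inner_add_right add_divide_distrib distrib_left)
    then obtain x where x: "\<And>v. ?g x v = inner w v"
    proof (rule coercive_form_represents[where f = "inner w" and U = UNIV])
      show "(norm u)\<^sup>2 \<le> ?g u u" for u
        using \<open>0 < \<gamma>\<close> by (simp add: power2_norm_eq_inner)
      show "?g u v = ?g v u" for u v by (simp add: inner_commute)
    qed (auto intro: bounded_linear_inner_right)
    have "inner v (?G x) = inner v w" for v
      using x[of v] by (simp add: form inner_commute)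
    then have "?G x = w" by (intro vector_eq_ldot[THEN iffD1]) blast
    then show "\<exists>x. w = ?G x" by blast
  qed
qed

text \<open>Gram--Schmidt for the semidefinite form \<open>inner (T u) (T v)\<close>: a new
  generator \<open>a\<close> contributes only through \<open>a - p\<close>, which is orthogonal to
  the old span in this form. Only existence is claimed, as \<open>T\<close> may have a
  kernel.\<close>

lemma finite_span_normal_equation:
  fixes T :: "'a::real_vector \<Rightarrow> 'b::real_inner"
  assumes "linear T" and "finite S"
  shows "\<exists>x\<in>span S. \<forall>v\<in>span S. inner (T (z - x)) (T v) = 0"
  using assms(2)
proof (induction S arbitrary: z rule: finite_induct)
  case empty
  then show ?case by (simp add: linear_0[OF assms(1)])
next
  case (insert a S)
  interpret T: linear T by (rule assms(1))
  obtain p where p: "p \<in> span S" "\<And>v. v \<in> span S \<Longrightarrow> inner (T (a - p)) (T v) = 0"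
    using insert.IH by blast
  obtain x where x: "x \<in> span S" "\<And>v. v \<in> span S \<Longrightarrow> inner (T (z - x)) (T v) = 0"
    using insert.IH by blast
  \<comment> \<open>If \<open>T (a - p) = 0\<close>, division by zero yields \<open>t = 0\<close>,
    which is acceptable because every pairing with \<open>T (a - p)\<close> is then zero.\<close>
  define t where "t = inner (T (z - x)) (T (a - p)) / inner (T (a - p)) (T (a - p))"
  have sub: "span S \<subseteq> span (insert a S)" by (intro span_mono) auto
  have "x + t *\<^sub>R (a - p) \<in> span (insert a S)"
    using p(1) x(1) sub
    by (intro span_add span_scale span_diff) (auto intro: span_base)
  moreover have "inner (T (z - (x + t *\<^sub>R (a - p)))) (T v) = 0" if v: "v \<in> span (insert a S)" for v
  proof -
    obtain k where k: "v - k *\<^sub>R a \<in> span S"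
      using v by (auto simp: span_insert)
    define w where "w = v - k *\<^sub>R a + k *\<^sub>R p"
    have w: "w \<in> span S" unfolding w_def using k p(1) by (intro span_add span_scale)
    have v_eq: "v = w + k *\<^sub>R (a - p)" by (simp add: w_def algebra_simps)
    have z_eq: "z - (x + t *\<^sub>R (a - p)) = (z - x) - t *\<^sub>R (a - p)" by simp
    have "inner (T (z - x)) (T (a - p)) = t * inner (T (a - p)) (T (a - p))"
      by (cases "T (a - p) = 0") (simp_all add: t_def)
    then show ?thesis
      unfolding z_eq v_eq T.add T.diff[of "z - x"] T.scale inner_add_right inner_diff_left
        inner_scaleR_right inner_scaleR_left
      using p(2)[OF w] x(2)[OF w] by simp
  qed
  ultimately show ?case by blast
qed

section \<open>The resolvent of the normal operator and its Krylov spaces\<close>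

text \<open>All spans and orthogonality relations here are real; the scalar field returns later. The
  data enter only through \<open>S (T z)\<close>, which equals \<open>S y\<close> when
  \<open>z\<close> is the Moore--Penrose solution, so \<open>y\<close> does not occur.\<close>

locale shifted_normal_equation =
  fixes T :: "'a::{real_inner, complete_space} \<Rightarrow> 'b::real_inner"
    and S :: "'b \<Rightarrow> 'a" and B :: "'a \<Rightarrow> 'a" and \<gamma> :: real and z :: 'a
  assumes T: "bounded_linear T" and S: "bounded_linear S"
    and adj: "inner (T u) v = inner u (S v)"
    and \<gamma>_pos: "0 < \<gamma>"
    and B_left: "B (u + (1 / \<gamma>) *\<^sub>R S (T u)) = u"
    and B_right: "B u + (1 / \<gamma>) *\<^sub>R S (T (B u)) = u"
    and z_perp: "T n = 0 \<Longrightarrow> inner z n = 0"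
begin

definition krylov :: "nat \<Rightarrow> 'a" where
  "krylov j = (B ^^ j) (S (T z))"

definition K :: "nat \<Rightarrow> 'a set" where
  "K m = span {krylov j | j. j < m}"

definition g :: "'a \<Rightarrow> 'a \<Rightarrow> real" where
  "g u v = inner u v + inner (T u) (T v) / \<gamma>"

sublocale T: bounded_linear T by (rule T)
sublocale S: bounded_linear S by (rule S)

lemma linear_B: "linear B"
proof (rule linearI)
  show "B (u + v) = B u + B v" for u v
  proof -
    have "B u + B v + (1 / \<gamma>) *\<^sub>R S (T (B u + B v))
        = (B u + (1 / \<gamma>) *\<^sub>R S (T (B u))) + (B v + (1 / \<gamma>) *\<^sub>R S (T (B v)))"
      by (simp add: T.add S.add scaleR_add_right)
    then show ?thesis using B_left[of "B u + B v"] by (simp only: B_right)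
  qed
  show "B (c *\<^sub>R u) = c *\<^sub>R B u" for c u
  proof -
    have "c *\<^sub>R B u + (1 / \<gamma>) *\<^sub>R S (T (c *\<^sub>R B u)) = c *\<^sub>R (B u + (1 / \<gamma>) *\<^sub>R S (T (B u)))"
      by (simp add: T.scale S.scale scaleR_add_right)
    then show ?thesis using B_left[of "c *\<^sub>R B u"] by (simp only: B_right)
  qed
qed

sublocale B: linear B by (rule linear_B)

text \<open>The inverse of a symmetric map is symmetric: the symmetry of the shifted map is
  evaluated at \<open>B u\<close> and \<open>B v\<close>.\<close>

lemma B_sym: "inner (B u) v = inner u (B v)"
proof -
  have "inner (B u) (B v + (1 / \<gamma>) *\<^sub>R S (T (B v))) = inner (B u + (1 / \<gamma>) *\<^sub>R S (T (B u))) (B v)"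
    using adj[of "B u" "T (B v)"] adj[of "B v" "T (B u)"]
    by (simp add: inner_add_left inner_add_right inner_commute)
  then show ?thesis by (simp only: B_right)
qed

text \<open>Resolvent identity. Together with \<open>B_ST\<close> it shows that \<open>B\<close>
  commutes with \<open>S \<circ> T\<close> and that \<open>B \<circ> S \<circ> T\<close> is affine
  in \<open>B\<close>, so the powers of \<open>B\<close> also generate the Krylov spaces of that
  operator.\<close>

lemma ST_B: "S (T (B u)) = \<gamma> *\<^sub>R (u - B u)"
proof -
  have "u - B u = (1 / \<gamma>) *\<^sub>R S (T (B u))"
    using B_right[of u] by (metis add_diff_cancel_left')
  then show ?thesis using \<gamma>_pos by simp
qed

lemma B_ST: "B (S (T u)) = \<gamma> *\<^sub>R (u - B u)"
proof -
  have "u - B u = (1 / \<gamma>) *\<^sub>R B (S (T u))"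
    using B_left[of u] by (simp add: B.add B.scale) (metis add_diff_cancel_left')
  then show ?thesis using \<gamma>_pos by simp
qed

lemma B_ker: "T n = 0 \<Longrightarrow> B n = n"
  using B_left[of n] by (simp add: S.zero)

lemma funpow_B_ker: "T n = 0 \<Longrightarrow> (B ^^ j) n = n"
  by (induction j) (simp_all add: B_ker)

lemma funpow_B_sym: "inner ((B ^^ j) u) v = inner u ((B ^^ j) v)"
proof (induction j arbitrary: v)
  case (Suc j)
  have "inner ((B ^^ Suc j) u) v = inner ((B ^^ j) u) (B v)" by (simp add: B_sym)
  also have "\<dots> = inner u ((B ^^ Suc j) v)" unfolding Suc.IH by (simp only: funpow_Suc_right o_apply)
  finally show ?case .
qed simp

lemma g_sym: "g u v = g v u"
  by (simp add: g_def inner_commute)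

lemma linear_g: "linear (g u)"
  by (rule linearI)
    (simp_all add: g_def T.add T.scale inner_add_right algebra_simps add_divide_distrib)

lemmas g_simps = linear_add[OF linear_g] linear_diff[OF linear_g] linear_cmul[OF linear_g]
  linear_0[OF linear_g]

lemma g_coercive: "(norm u)\<^sup>2 \<le> g u u"
  using \<gamma>_pos by (simp add: g_def power2_norm_eq_inner)

lemma g_nonneg: "0 \<le> g u u"
  by (rule order_trans[OF zero_le_power2 g_coercive])

text \<open>\<open>g\<close> is the inner product weighted by the shifted map, and this weight
  cancels \<open>B\<close>.\<close>

lemma g_C: "g v (B (S (T u))) = inner (T u) (T v)"
proof -
  have "g v w = inner v (w + (1 / \<gamma>) *\<^sub>R S (T w))" for w
    by (simp add: g_def inner_add_right adj)
  then have "g v (B (S (T u))) = inner v (S (T u))" by (simp only: B_right)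
  then show ?thesis by (simp add: inner_commute flip: adj)
qed

lemma subspace_K: "subspace (K m)"
  by (simp add: K_def)

lemma K_mono: "m \<le> n \<Longrightarrow> K m \<subseteq> K n"
  unfolding K_def by (intro span_mono) auto

lemma krylov_in_K: "j < m \<Longrightarrow> krylov j \<in> K m"
  unfolding K_def by (intro span_base) auto

lemma K_0: "K 0 = {0}"
  by (simp add: K_def)

lemma K_Suc: "K (Suc m) = span (insert (krylov m) (K m))"
proof -
  have "{krylov j | j. j < Suc m} = insert (krylov m) {krylov j | j. j < m}"
    by (auto simp: less_Suc_eq)
  then show ?thesis
    unfolding K_def by (simp add: span_insert span_span)
qed

lemma B_K: "u \<in> K m \<Longrightarrow> B u \<in> K (Suc m)"
  unfolding K_def
proof (induction rule: span_induct)
  case base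
  show ?case
    by (auto simp: subspace_def B.zero B.add B.scale span_zero span_add span_scale)
next
  case (step x)
  then obtain j where "x = krylov j" "j < m" by auto
  then have "B x = krylov (Suc j)" by (simp add: krylov_def)
  then show ?case using \<open>j < m\<close> by (auto intro: span_base)
qed

lemma C_K: "u \<in> K m \<Longrightarrow> B (S (T u)) \<in> K (Suc m)"
  unfolding B_ST using B_K K_mono[of m "Suc m"]
  by (intro subspace_scale[OF subspace_K] subspace_diff[OF subspace_K]) auto

text \<open>The range of \<open>S\<close> is orthogonal to the kernel of \<open>T\<close>, and
  powers of \<open>B\<close> preserve this, being symmetric and fixing that kernel
  pointwise.\<close>

lemma K_perp_ker: 
  assumes "T n = 0" "u \<in> K m"
  shows "inner u n = 0"
  using assms(2) unfolding K_def
proof (induction rule: span_induct)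
  case base
  show ?case by (auto simp: subspace_def inner_add_left)
next
  case (step x)
  then obtain j where "x = krylov j" by auto
  then have "inner x n = inner (S (T z)) n"
    by (simp add: krylov_def funpow_B_sym funpow_B_ker assms(1))
  also have "\<dots> = inner (T n) (T z)" unfolding adj by (rule inner_commute)
  finally show ?case using assms(1) by simp
qed

end

section \<open>Conjugate gradients: orthogonal residuals and convergence\<close>

text \<open>
  Replacing the error \<open>z - x 0 = z\<close> by \<open>z + (1 / \<gamma>) *\<^sub>R S (T z)\<close> at index \<open>0\<close> makes \<open>e\<close> the error
  sequence of the conjugate gradient method for the operator \<open>B \<circ> S \<circ> T\<close> in the inner product \<open>g\<close>:
  the residuals \<open>r m\<close> are \<open>g\<close>-orthogonal and, until one vanishes, span the spaces \<open>K m\<close>.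
\<close>

locale shifted_normal_iterates = shifted_normal_equation +
  fixes x :: "nat \<Rightarrow> 'a"
  assumes x_in: "x m \<in> K m"
    and x_opt: "v \<in> K m \<Longrightarrow> inner (T (z - x m)) (T v) = 0"
begin

definition e :: "nat \<Rightarrow> 'a" where
  "e m = (if m = 0 then z + (1 / \<gamma>) *\<^sub>R S (T z) else z - x m)"

definition r :: "nat \<Rightarrow> 'a" where
  "r m = B (S (T (e m)))"

lemma e_opt: "v \<in> K m \<Longrightarrow> inner (T (e m)) (T v) = 0"
  by (cases "m = 0") (auto simp: e_def x_opt K_0 T.zero)

lemma e_diff: "k \<le> m \<Longrightarrow> e k - e m \<in> K m"
proof -
  \<comment> \<open>The case \<open>m = 0\<close> is excluded because \<open>z - e 0\<close> is a
    multiple of \<open>krylov 0\<close>, which \<open>K 0\<close> need not contain.\<close>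
  have *: "z - e i \<in> K m" if "i \<le> m" "0 < m" for i
  proof (cases "i = 0")
    case True
    have "krylov 0 \<in> K m" using that by (intro krylov_in_K)
    then have "(- 1 / \<gamma>) *\<^sub>R krylov 0 \<in> K m" by (intro subspace_scale[OF subspace_K])
    then show ?thesis using True by (simp add: e_def krylov_def)
  next
    case False
    then show ?thesis using x_in[of i] K_mono[OF that(1)] by (auto simp: e_def)
  qed
  assume "k \<le> m"
  show ?thesis
  proof (cases "m = 0")
    case True
    then show ?thesis using \<open>k \<le> m\<close> by (simp add: K_0)
  next
    case False
    then have "z - e m \<in> K m" "z - e k \<in> K m" using * \<open>k \<le> m\<close> by blast+
    then have "(z - e m) - (z - e k) \<in> K m" by (rule subspace_diff[OF subspace_K])
    then show ?thesis by simp
  qed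
qed

lemma r_in: "r m \<in> K (Suc m)"
proof (cases "m = 0")
  case True
  \<comment> \<open>Here the modified start matters: \<open>B\<close> undoes the shift in
    \<open>e 0\<close>, so the first residual is \<open>krylov 0\<close>. The error \<open>z\<close>
    would give \<open>krylov 1\<close> instead.\<close>
  have "r m = S (T (B (z + (1 / \<gamma>) *\<^sub>R S (T z))))"
    using True unfolding r_def e_def B_ST ST_B by simp
  then have "r m = krylov 0" by (simp only: B_left krylov_def funpow_0)
  then show ?thesis using krylov_in_K by simp
next
  case False
  have "r m = B (S (T z)) - B (S (T (x m)))"
    using False unfolding r_def e_def by (simp add: T.diff S.diff B.diff)
  moreover have "B (S (T z)) = krylov 1" by (simp add: krylov_def)
  moreover have "krylov 1 \<in> K (Suc m)" using False by (simp add: krylov_in_K)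
  ultimately show ?thesis using subspace_diff[OF subspace_K _ C_K[OF x_in]] by metis
qed

lemma g_r: "g v (r m) = inner (T (e m)) (T v)"
  by (simp add: r_def g_C)

text \<open>The earlier residual lies in the Krylov space against which the later error is optimal,
  and \<open>g_r\<close> turns that optimality into \<open>g\<close>-orthogonality.\<close>

lemma r_orth: "i \<noteq> j \<Longrightarrow> g (r i) (r j) = 0"
proof (induction i j rule: linorder_wlog)
  case (le i j)
  then have "r i \<in> K j" using r_in[of i] K_mono[of "Suc i" j] by auto
  then show ?case by (simp add: g_r e_opt)
next
  case (sym i j)
  then show ?case using g_sym[of "r i" "r j"] by auto
qed

lemma e_perp_ker:
  assumes "T n = 0"
  shows "inner (e m) n = 0"
proof (cases "m = 0")
  case True
  have "inner (S (T z)) n = inner (T n) (T z)" unfolding adj by (rule inner_commute)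
  then show ?thesis
    using True assms by (simp add: e_def inner_add_left z_perp)
next
  case False
  then show ?thesis
    using K_perp_ker[OF assms x_in] assms by (simp add: e_def inner_diff_left z_perp)
qed

definition \<phi> :: "nat \<Rightarrow> real" where
  "\<phi> n = inner (T (e n)) (T (e n))"

text \<open>For \<open>i \<le> j\<close> the difference \<open>e i - e j\<close> lies in
  \<open>K j\<close>, and \<open>T (e j)\<close> is orthogonal to the image of \<open>K j\<close>;
  hence only the later error contributes.\<close>

lemma T_e_inner: "inner (T (e i)) (T (e j)) = \<phi> (max i j)"
proof (induction i j rule: linorder_wlog)
  case (le i j)
  have "inner (T (e j)) (T (e i)) = inner (T (e j)) (T (e j)) + inner (T (e j)) (T (e i - e j))"
    by (simp add: T.diff inner_diff_right)
  then show ?case using le e_opt[OF e_diff[OF le]] by (simp add: \<phi>_def inner_commute)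
next
  case (sym i j)
  then show ?case by (simp add: inner_commute max.commute)
qed

lemma decseq_\<phi>: "decseq \<phi>"
proof (rule decseq_SucI)
  fix n
  have "0 \<le> inner (T (e n - e (Suc n))) (T (e n - e (Suc n)))" by simp
  also have "\<dots> = \<phi> n - \<phi> (Suc n)"
    by (simp add: T.diff inner_diff_left inner_diff_right T_e_inner)
  finally show "\<phi> (Suc n) \<le> \<phi> n" by simp
qed

text \<open>Each step enlarges the space by at most one generator. A nonzero \<open>r m\<close>
  cannot lie in \<open>K m\<close>, where it would be \<open>g\<close>-orthogonal to itself, so the
  exchange lemma lets it replace \<open>krylov m\<close>.\<close>

lemma K_subset_span_r:
  assumes nz: "\<And>i. r i \<noteq> 0"
  shows "K m \<subseteq> span (r ` {..<m})"
proof (induction m)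
  case (Suc m)
  have "r m \<notin> K m"
  proof
    assume "r m \<in> K m"
    then have "g (r m) (r m) = 0" by (simp add: g_r e_opt)
    then show False using g_coercive[of "r m"] nz[of m] by simp
  qed
  then have "r m \<notin> span (K m)"
    unfolding span_eq_iff[THEN iffD2, OF subspace_K] .
  then have krylov_m: "krylov m \<in> span (insert (r m) (K m))"
    using in_span_insert[OF r_in[of m, unfolded K_Suc]] by blast
  have "span (r ` {..<m}) \<subseteq> span (r ` {..<Suc m})" by (intro span_mono) auto
  then have "K m \<subseteq> span (r ` {..<Suc m})" using Suc.IH by (rule order_trans[rotated])
  then have "insert (r m) (K m) \<subseteq> span (r ` {..<Suc m})" by (simp add: span_base)
  moreover have "span (insert (r m) (K m)) \<subseteq> span (r ` {..<Suc m})"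
    using \<open>insert (r m) (K m) \<subseteq> span (r ` {..<Suc m})\<close> by (intro span_minimal subspace_span)
  ultimately have "krylov m \<in> span (r ` {..<Suc m})" using krylov_m by blast
  then show ?case
    using \<open>K m \<subseteq> span (r ` {..<Suc m})\<close> unfolding K_Suc
    by (intro span_minimal subspace_span) simp
qed (simp add: K_0 span_zero)

text \<open>Both sides are linear in \<open>u\<close>, so it suffices to check the orthogonal
  generators \<open>r j\<close>, where a single summand survives.\<close>

lemma parseval_r:
  assumes nz: "\<And>i. r i \<noteq> 0" and "u \<in> K m"
  shows "g v u = (\<Sum>i<m. g u (r i) * g v (r i) / g (r i) (r i))"
proof -
  have "u \<in> span (r ` {..<m})" using K_subset_span_r[OF nz] assms(2) by blast
  then show ?thesis
  proof (induction rule: span_induct)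
    case base
    have "linear (\<lambda>u. g v u - (\<Sum>i<m. g u (r i) * g v (r i) / g (r i) (r i)))"
    proof (intro linear_compose_sub linear_g linear_compose_sum ballI)
      fix i
      have "g u (r i) * g v (r i) / g (r i) (r i) = (g v (r i) / g (r i) (r i)) *\<^sub>R g (r i) u" for u
        by (simp add: g_sym[of u])
      then show "linear (\<lambda>u. g u (r i) * g v (r i) / g (r i) (r i))"
        by (simp only:) (intro linear_compose_scale_right linear_g)
    qed
    then show ?case
      using real_vector.linear_subspace_kernel by force
  next
    case (step w)
    then obtain j where j: "w = r j" "j < m" by auto
    have pos: "g (r j) (r j) \<noteq> 0" using g_coercive[of "r j"] nz[of j] by auto
    have "(\<Sum>i<m. g (r j) (r i) * g v (r i) / g (r i) (r i)) = (\<Sum>i<m. if i = j then g v (r j) else 0)"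
      using pos r_orth by (intro sum.cong) auto
    then show ?case using j by simp
  qed
qed

text \<open>In the expansion along the residuals, the coefficients of \<open>e k - e m\<close> are
  drops of the decreasing sequence \<open>\<phi>\<close> and those of \<open>e m\<close> are values
  of \<open>\<phi>\<close>; every summand is nonnegative.\<close>

lemma g_e_increment_nonneg:
  assumes nz: "\<And>i. r i \<noteq> 0" and "k \<le> m"
  shows "0 \<le> g (e m) (e k - e m)"
proof -
  have "0 \<le> g (e k - e m) (r i) * g (e m) (r i) / g (r i) (r i)" for i
  proof -
    have "g (e k - e m) (r i) = \<phi> (max i k) - \<phi> (max i m)"
      by (simp add: g_r T.diff inner_diff_right T_e_inner)
    also have "\<dots> \<ge> 0" using decseqD[OF decseq_\<phi>, of "max i k" "max i m"] \<open>k \<le> m\<close> by simp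
    moreover have "0 \<le> g (e m) (r i)" unfolding g_r T_e_inner by (simp add: \<phi>_def)
    moreover have "0 \<le> g (r i) (r i)" by (rule g_nonneg)
    ultimately show ?thesis by simp
  qed
  then show ?thesis
    by (subst parseval_r[OF nz e_diff[OF \<open>k \<le> m\<close>]]) (rule sum_nonneg)
qed

lemma Cauchy_e:
  assumes nz: "\<And>i. r i \<noteq> 0"
  shows "Cauchy e"
proof -
  define q where "q m = g (e m) (e m)" for m
  \<comment> \<open>Expanding \<open>q k\<close> around \<open>e m\<close> leaves a nonnegative
    cross term. Thus \<open>q\<close> decreases, and its convergence controls the distances between
    errors.\<close>
  have gap: "(norm (e k - e m))\<^sup>2 \<le> q k - q m" if "k \<le> m" for k m
  proof -
    have "q k = q m + 2 * g (e m) (e k - e m) + g (e k - e m) (e k - e m)"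
      by (simp add: q_def g_simps g_sym[of "e k - e m"] g_sym[of "e k" "e m"])
    then show ?thesis using g_e_increment_nonneg[OF nz that] g_coercive[of "e k - e m"] by linarith
  qed
  have "decseq q"
  proof (rule decseq_SucI)
    show "q (Suc n) \<le> q n" for n
      using gap[of n "Suc n"] zero_le_power2[of "norm (e n - e (Suc n))"] by linarith
  qed
  moreover have "\<forall>i. 0 \<le> q i"
    by (simp add: q_def g_nonneg)
  ultimately obtain L where "q \<longlonglongrightarrow> L" by (rule decseq_convergent)
  then have "Cauchy q" by (intro convergent_Cauchy convergentI)
  show ?thesis
  proof (rule metric_CauchyI)
    fix \<epsilon> :: real assume "0 < \<epsilon>"
    then obtain N where N: "\<And>i j. N \<le> i \<Longrightarrow> N \<le> j \<Longrightarrow> dist (q i) (q j) < \<epsilon>\<^sup>2"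
      using metric_CauchyD[OF \<open>Cauchy q\<close>, of "\<epsilon>\<^sup>2"] by auto
    have *: "dist (e i) (e j) < \<epsilon>" if "N \<le> i" "i \<le> j" for i j
    proof -
      have "(norm (e i - e j))\<^sup>2 < \<epsilon>\<^sup>2"
        using gap[OF that(2)] N[of i j] that by (auto simp: dist_real_def)
      then show ?thesis using \<open>0 < \<epsilon>\<close> by (simp add: dist_norm power_less_imp_less_base)
    qed
    then have "dist (e i) (e j) < \<epsilon>" if "N \<le> i" "N \<le> j" for i j
      using that *[of i j] *[of j i] by (cases i j rule: le_cases) (simp_all add: dist_commute)
    then show "\<exists>N. \<forall>i\<ge>N. \<forall>j\<ge>N. dist (e i) (e j) < \<epsilon>" by blast
  qed
qed

lemma e_tendsto_0_if_residuals_nonzero: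
  assumes nz: "\<And>i. r i \<noteq> 0"
  shows "e \<longlonglongrightarrow> 0"
proof -
  obtain a where a: "e \<longlonglongrightarrow> a"
    using Cauchy_e[OF nz] Cauchy_convergent convergent_def by blast
  \<comment> \<open>For fixed \<open>n\<close> all later errors are optimal against
    \<open>r n\<close>; the limit inherits this orthogonality.\<close>
  have "inner (T a) (T (r n)) = 0" for n
  proof (rule LIMSEQ_unique)
    show "(\<lambda>m. inner (T (e m)) (T (r n))) \<longlonglongrightarrow> inner (T a) (T (r n))"
      by (intro tendsto_intros T.tendsto a)
    have "inner (T (e m)) (T (r n)) = 0" if "Suc n \<le> m" for m
      using r_in[of n] K_mono[OF that] by (intro e_opt) auto
    then show "(\<lambda>m. inner (T (e m)) (T (r n))) \<longlonglongrightarrow> 0"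
      by (intro tendsto_eventually eventually_sequentiallyI[of "Suc n"])
  qed
  \<comment> \<open>Selfadjointness in \<open>g\<close> moves the operator from \<open>e n\<close>
    to \<open>a\<close>, leaving an expression continuous in \<open>e n\<close>, so that
    \<open>n\<close> can tend to infinity.\<close>
  moreover have "inner (T a) (T (r n)) = inner (B (S (T a))) (S (T (e n)))" for n
  proof -
    have "inner (T a) (T (r n)) = g (r n) (B (S (T a)))" by (simp add: g_C)
    also have "\<dots> = g (B (S (T a))) (r n)" by (rule g_sym)
    also have "\<dots> = inner (T (B (S (T a)))) (T (e n))" by (simp add: g_r inner_commute)
    finally show ?thesis by (simp add: adj)
  qed
  ultimately have "(\<lambda>n. inner (B (S (T a))) (S (T (e n)))) = (\<lambda>n. 0)" by simp
  moreover have "(\<lambda>n. inner (B (S (T a))) (S (T (e n)))) \<longlonglongrightarrow> inner (B (S (T a))) (S (T a))"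
    by (intro tendsto_intros T.tendsto S.tendsto a)
  ultimately have "inner (B (S (T a))) (S (T a)) = 0"
    by (simp add: LIMSEQ_const_iff)
  moreover have "g (B (S (T a))) (B (S (T a))) = inner (B (S (T a))) (S (T a))"
    unfolding g_C by (subst inner_commute) (rule adj)
  ultimately have "B (S (T a)) = 0" using g_coercive[of "B (S (T a))"] by simp
  then have "S (T a) = 0" using B_right[of "S (T a)"] by (simp add: T.zero S.zero)
  then have "inner (T a) (T a) = 0" by (simp add: adj)
  then have "T a = 0" by simp
  \<comment> \<open>The limit \<open>a\<close> lies in the kernel of \<open>T\<close>, to which all
    errors are orthogonal, so \<open>a\<close> is orthogonal to itself.\<close>
  then have "(\<lambda>m. inner (e m) a) = (\<lambda>m. 0)" by (simp add: e_perp_ker)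
  moreover have "(\<lambda>m. inner (e m) a) \<longlonglongrightarrow> inner a a" by (intro tendsto_intros a)
  ultimately have "a = 0" by (simp add: LIMSEQ_const_iff)
  then show ?thesis using a by simp
qed

lemma e_tendsto_0: "e \<longlonglongrightarrow> 0"
proof (cases "\<exists>n. r n = 0")
  case True
  then obtain n where "r n = 0" by blast
  \<comment> \<open>A vanishing residual means finite termination: \<open>\<phi>\<close> stays zero
    from \<open>n\<close> on, which puts each later error both in the kernel of \<open>T\<close> and
    orthogonal to it.\<close>
  have "\<phi> n = g (e n) (r n)" by (simp add: \<phi>_def g_r)
  then have "\<phi> n = 0" using \<open>r n = 0\<close> by (simp add: g_simps)
  have "e m = 0" if "n \<le> m" for m
  proof -
    have "\<phi> m \<le> 0" using decseqD[OF decseq_\<phi> that] \<open>\<phi> n = 0\<close> by simp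
    then have "T (e m) = 0" by (simp add: \<phi>_def flip: power2_norm_eq_inner)
    then have "inner (e m) (e m) = 0" by (rule e_perp_ker)
    then show ?thesis by simp
  qed
  then show ?thesis
    by (intro tendsto_eventually eventually_sequentiallyI[of n])
qed (use e_tendsto_0_if_residuals_nonzero in blast)

lemma x_tendsto: "x \<longlonglongrightarrow> z"
proof -
  \<comment> \<open>Index \<open>0\<close> is skipped, since \<open>e 0\<close> is not the error of
    \<open>x 0\<close>.\<close>
  have "(\<lambda>n. z - e (Suc n)) \<longlonglongrightarrow> z - 0"
    by (intro tendsto_intros LIMSEQ_Suc e_tendsto_0)
  then have "(\<lambda>n. x (Suc n)) \<longlonglongrightarrow> z" by (simp add: e_def)
  then show ?thesis by (rule LIMSEQ_imp_Suc)
qed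

end

section \<open>Inner products over the scalar field\<close>

lemma conjug_of_real: "conjug (of_real r :: 'k::real_or_complex) = of_real r"
proof (cases "r = 0")
  case True
  then show ?thesis using conjug_add[of "0 :: 'k" 0] by simp
next
  case False
  have "of_real r * conjug (of_real r :: 'k) = of_real r * of_real r"
    by (simp add: mult_conjug of_real_def power2_eq_square)
  then show ?thesis using False by simp
qed

context hilbert_space
begin

lemma ip_add_right: "ip x (u + v) = ip x u + ip x v"
  using ip_conjug[of x "u + v"] ip_conjug[of x u] ip_conjug[of x v]
  by (simp add: ip_add_left conjug_add)

lemma ip_zero_left: "ip 0 x = 0"
  using ip_add_left[of 0 0 x] by simp

lemma ip_zero_right: "ip x 0 = 0"
  using ip_add_right[of x 0 0] by simp

lemma ip_diff_left: "ip (u - v) x = ip u x - ip v x"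
  using ip_add_left[of "u - v" v x] by simp

lemma ip_diff_right: "ip x (u - v) = ip x u - ip x v"
  using ip_add_right[of x "u - v" v] by simp

lemma ip_scaleR_left: "ip (c *\<^sub>R u) x = of_real c * ip u x"
  by (simp add: ip_scale_left flip: scale_of_real)

lemma ip_scale_right: "ip x (scale a u) = conjug a * ip x u"
  using ip_conjug[of x "scale a u"] ip_conjug[of x u] by (simp add: ip_scale_left conjug_mult)

lemma ip_scaleR_right: "ip x (c *\<^sub>R u) = of_real c * ip x u"
  by (simp add: ip_scale_right conjug_of_real flip: scale_of_real)

lemma ip_zero_commute: "ip u v = 0 \<Longrightarrow> ip v u = 0"
  using ip_conjug[of v u] conjug_of_real[of 0, where 'k = 'k] by simp

text \<open>\<open>ip\<close> and \<open>inner\<close> are linked only through the common norm;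
  polarisation identifies \<open>inner\<close> as the real part of \<open>ip\<close>.\<close>

lemma of_real_inner: "of_real (2 * inner u v) = ip u v + ip v u"
proof -
  have "of_real ((norm (u + v))\<^sup>2) = ip (u + v) (u + v)" by (simp only: ip_self)
  also have "\<dots> = ip u u + ip v v + (ip u v + ip v u)"
    by (simp add: ip_add_left ip_add_right)
  also have "ip u u + ip v v = of_real ((norm u)\<^sup>2 + (norm v)\<^sup>2)"
    by (simp only: ip_self of_real_add)
  finally have "ip u v + ip v u = of_real ((norm (u + v))\<^sup>2 - ((norm u)\<^sup>2 + (norm v)\<^sup>2))"
    by (simp only: of_real_diff) (simp add: algebra_simps)
  also have "(norm (u + v))\<^sup>2 - ((norm u)\<^sup>2 + (norm v)\<^sup>2) = 2 * inner u v"
    by (simp add: power2_norm_eq_inner inner_add_left inner_add_right inner_commute)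
  finally show ?thesis by simp
qed

lemma ip_eq_of_real_inner: "ip u v = ip v u \<Longrightarrow> ip u v = of_real (inner u v)"
  using of_real_inner[of u v] by simp

lemma inner_eq_0_if_ip_eq_0: "ip u v = 0 \<Longrightarrow> inner u v = 0"
  using of_real_inner[of u v] ip_zero_commute[of u v] by simp

lemma ip_eq_0_all: "(\<And>u. ip u v = 0) \<Longrightarrow> v = 0"
  using ip_self[of v] by simp

end

text \<open>Real parts tested against all scalar multiples determine the scalar product. Allowing
  two spaces makes this applicable to the adjoint identity.\<close>

lemma ip_eqI:
  fixes scaleX :: "'k::real_or_complex \<Rightarrow> 'x::{real_inner, complete_space} \<Rightarrow> 'x"
    and scaleY :: "'k \<Rightarrow> 'y::{real_inner, complete_space} \<Rightarrow> 'y"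
  assumes "hilbert_space scaleX ipX" and "hilbert_space scaleY ipY"
    and inner_eq: "\<And>a. inner (scaleX a x) u = inner (scaleY a y) v"
  shows "ipX x u = ipY y v"
proof -
  interpret X: hilbert_space scaleX ipX by (rule assms(1))
  interpret Y: hilbert_space scaleY ipY by (rule assms(2))
  define c where "c = ipX x u - ipY y v"
  have cc: "conjug c * c = of_real ((norm c)\<^sup>2)"
    using mult_conjug[of c] by (simp add: of_real_def mult.commute)
  have diff: "conjug p - conjug q = conjug (p - q)" for p q :: 'k
    using conjug_add[of "p - q" q] by simp
  have "ipX (scaleX a x) u + conjug (ipX (scaleX a x) u)
      = ipY (scaleY a y) v + conjug (ipY (scaleY a y) v)" for a
    using X.of_real_inner[of "scaleX a x" u] Y.of_real_inner[of "scaleY a y" v] inner_eq[of a]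
    by (simp add: X.ip_conjug[of u "scaleX a x"] Y.ip_conjug[of v "scaleY a y"])
  then have "a * c + conjug (a * c) = 0" for a
    unfolding c_def X.ip_scale_left Y.ip_scale_left right_diff_distrib diff[symmetric]
    by (metis add_diff_add diff_self)
  \<comment> \<open>The multiplier \<open>conjug c\<close> turns the real part of
    \<open>a * c\<close> into the squared norm of the discrepancy \<open>c\<close>.\<close>
  from this[of "conjug c"] have "of_real (2 * (norm c)\<^sup>2) = (0 :: 'k)"
    by (simp only: cc conjug_of_real) simp
  then show ?thesis by (simp add: c_def)
qed

lemma (in hilbert_space) ip_eq_0_if_inner_eq_0:
  "(\<And>a. inner (scale a u) v = 0) \<Longrightarrow> ip u v = 0"
  using ip_eqI[OF hilbert_space_axioms hilbert_space_axioms, of u v u 0]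
  by (simp add: ip_zero_right)

section \<open>Krylov spaces over the scalar field\<close>

text \<open>
  The real orthogonality relations that characterise the minimiser over the real Krylov space
  already hold over \<open>'k\<close>, since all inner products between Krylov vectors are real.
\<close>

locale hilbert_normal_iterates = X: hilbert_space scaleX ipX + Y: hilbert_space scaleY ipY
    + shifted_normal_iterates T S B \<gamma> z x
  for scaleX :: "'k::real_or_complex \<Rightarrow> 'x::{real_inner, complete_space} \<Rightarrow> 'x"
    and scaleY :: "'k \<Rightarrow> 'y::{real_inner, complete_space} \<Rightarrow> 'y"
    and ipX ipY and T :: "'x \<Rightarrow> 'y" and S B \<gamma> z x +
  assumes T_scale: "T (scaleX a u) = scaleY a (T u)"
    and ip_adj: "ipY (T u) v = ipX u (S v)"
begin

definition Q :: "nat \<Rightarrow> 'x set" where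
  "Q m = X.span {krylov j | j. j < m}"

lemma ip_adj': "ipX (S v) u = ipY v (T u)"
  using X.ip_conjug[of "S v" u] Y.ip_conjug[of v "T u"] by (simp add: ip_adj)

lemma ip_B: "ipX (B u) v = ipX u (B v)"
proof -
  have "ipX (B u) (B v + (1 / \<gamma>) *\<^sub>R S (T (B v))) = ipX (B u + (1 / \<gamma>) *\<^sub>R S (T (B u))) (B v)"
    by (simp add: X.ip_add_left X.ip_add_right X.ip_scaleR_left X.ip_scaleR_right ip_adj'
        flip: ip_adj)
  then show ?thesis by (simp only: B_right)
qed

lemma ip_funpow_B: "ipX ((B ^^ j) u) v = ipX u ((B ^^ j) v)"
proof (induction j arbitrary: v)
  case (Suc j)
  have "ipX ((B ^^ Suc j) u) v = ipX ((B ^^ j) u) (B v)" by (simp add: ip_B)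
  also have "\<dots> = ipX u ((B ^^ Suc j) v)" unfolding Suc.IH by (simp only: funpow_Suc_right o_apply)
  finally show ?case .
qed simp

lemma ST_funpow_B: "S (T ((B ^^ j) u)) = (B ^^ j) (S (T u))"
  by (induction j) (simp_all add: ST_B flip: B_ST)

text \<open>Symmetry of \<open>B\<close> makes the product depend on \<open>i + j\<close> alone.
  Being unchanged under exchange of its arguments, it is real by
  \<open>ip_eq_of_real_inner\<close>.\<close>

lemma ip_krylov_commute: "ipX (krylov i) (krylov j) = ipX (krylov j) (krylov i)"
proof -
  have "ipX (krylov i) (krylov j) = ipX (krylov 0) ((B ^^ (i + j)) (S (T z)))" for i j
    by (simp add: krylov_def ip_funpow_B funpow_add)
  then show ?thesis by (metis add.commute)
qed

lemma ip_T_krylov_commute: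
  "ipY (T (krylov i)) (T (krylov j)) = ipY (T (krylov j)) (T (krylov i))"
proof -
  have "ipY (T (krylov i)) (T (krylov j)) = ipX (krylov 0) ((B ^^ (i + j)) (S (T (S (T z)))))" for i j
    by (simp add: krylov_def ip_adj ip_funpow_B ST_funpow_B funpow_add)
  then show ?thesis by (metis add.commute)
qed

lemma ip_T_krylov_real:
  assumes "u \<in> K m"
  shows "ipY (T u) (T (krylov j)) = of_real (inner (T u) (T (krylov j)))"
  using assms unfolding K_def
proof (induction rule: span_induct)
  case base
  show ?case
    by (auto simp: subspace_def T.zero T.add T.scale Y.ip_zero_left Y.ip_add_left
        Y.ip_scaleR_left inner_add_left)
next
  case (step w)
  then show ?case using Y.ip_eq_of_real_inner[OF ip_T_krylov_commute] by auto
qed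

lemma ip_error_krylov:
  assumes "j < m"
  shows "ipY (T (z - x m)) (T (krylov j)) = 0"
proof -
  have "ipY (T z) (T (krylov j)) = ipX (krylov 0) (krylov j)"
    by (simp add: krylov_def ip_adj')
  moreover have "ipY (T (krylov j)) (T z) = ipX (krylov j) (krylov 0)"
    by (simp add: krylov_def ip_adj)
  ultimately have "ipY (T z) (T (krylov j)) = of_real (inner (T z) (T (krylov j)))"
    by (intro Y.ip_eq_of_real_inner) (simp add: ip_krylov_commute)
  then have "ipY (T (z - x m)) (T (krylov j)) = of_real (inner (T (z - x m)) (T (krylov j)))"
    by (simp add: T.diff Y.ip_diff_left inner_diff_left ip_T_krylov_real[OF x_in])
  also have "\<dots> = 0" using x_opt[OF krylov_in_K[OF assms]] by simp
  finally show ?thesis .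
qed

lemma x_opt_Q:
  assumes "v \<in> Q m"
  shows "inner (T (z - x m)) (T v) = 0"
proof -
  have "ipY (T (z - x m)) (T v) = 0"
    using assms unfolding Q_def
  proof (induction rule: X.span_induct)
    case base
    show ?case
      by (auto simp: X.subspace_def T.zero T.add T_scale Y.ip_zero_right Y.ip_add_right
          Y.ip_scale_right)
  next
    case (step w)
    then show ?case using ip_error_krylov by auto
  qed
  then show ?thesis by (rule Y.inner_eq_0_if_ip_eq_0)
qed

lemma x_in_Q: "x m \<in> Q m"
proof -
  have "subspace (Q m)"
    unfolding Q_def subspace_def
    by (auto intro: X.span_zero X.span_add X.span_scale simp flip: X.scale_of_real)
  then have "K m \<subseteq> Q m"
    unfolding K_def by (intro span_minimal) (auto simp: Q_def intro: X.span_base)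
  then show ?thesis using x_in by blast
qed

lemma Q_perp_ker:
  assumes "T n = 0" and "u \<in> Q m"
  shows "ipX u n = 0"
  using assms(2) unfolding Q_def
proof (induction rule: X.span_induct)
  case base
  show ?case
    by (auto simp: X.subspace_def X.ip_zero_left X.ip_add_left X.ip_scale_left)
next
  case (step w)
  then obtain j where "w = krylov j" by auto
  then have "ipX w n = ipX (S (T z)) n"
    by (simp add: krylov_def ip_funpow_B funpow_B_ker assms(1))
  then show ?case by (simp add: ip_adj' assms(1) Y.ip_zero_right)
qed

lemma arg_min_eq:
  assumes "S y = S (T z)"
  shows "(ARG_MIN (\<lambda>u. norm (y - T u)) u. u \<in> Q m) = x m"
proof -
  \<comment> \<open>Besides the optimality of \<open>x m\<close>, this uses that
    \<open>y - T z\<close> is orthogonal to the range of \<open>T\<close>, which is what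
    \<open>S y = S (T z)\<close> expresses.\<close>
  have pythagoras: "(norm (y - T u))\<^sup>2 = (norm (y - T (x m)))\<^sup>2 + (norm (T (x m - u)))\<^sup>2"
    if "u \<in> Q m" for u
  proof -
    have "x m - u \<in> Q m"
      using x_in_Q that unfolding Q_def by (rule X.span_diff)
    then have "inner (T (z - x m)) (T (x m - u)) = 0" by (rule x_opt_Q)
    moreover have "inner (y - T z) (T (x m - u)) = 0"
      using adj[of "x m - u" "y - T z"] assms by (simp add: S.diff inner_commute)
    ultimately have "inner (y - T (x m)) (T (x m - u)) = 0"
      by (simp add: T.diff inner_diff_left)
    moreover have "y - T u = (y - T (x m)) + T (x m - u)" by (simp add: T.diff)
    ultimately show ?thesis
      by (simp only:) (simp add: power2_norm_eq_inner inner_add_left inner_add_right inner_commute)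
  qed
  have "is_arg_min (\<lambda>u. norm (y - T u)) (\<lambda>u. u \<in> Q m) (x m)"
    unfolding is_arg_min_linorder
  proof (intro conjI allI impI x_in_Q)
    fix u assume "u \<in> Q m"
    then have "(norm (y - T (x m)))\<^sup>2 \<le> (norm (y - T u))\<^sup>2" using pythagoras by simp
    then show "norm (y - T (x m)) \<le> norm (y - T u)" by (rule power2_le_imp_le) simp
  qed
  \<comment> \<open>Uniqueness fixes the value of \<open>ARG_MIN\<close>. Equal images under
    \<open>T\<close> suffice, because differences in \<open>Q m\<close> are orthogonal to the kernel
    of \<open>T\<close>.\<close>
  moreover have "u = x m" if "is_arg_min (\<lambda>u. norm (y - T u)) (\<lambda>u. u \<in> Q m) u" for u
  proof -
    have u: "u \<in> Q m" and le: "norm (y - T u) \<le> norm (y - T (x m))"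
      using that x_in_Q by (auto simp: is_arg_min_linorder)
    have "(norm (y - T u))\<^sup>2 \<le> (norm (y - T (x m)))\<^sup>2"
      using le by (intro power_mono) auto
    then have "(norm (T (x m - u)))\<^sup>2 \<le> 0" using pythagoras[OF u] by simp
    then have "T (x m - u) = 0" by simp
    moreover have "x m - u \<in> Q m"
      using x_in_Q u unfolding Q_def by (rule X.span_diff)
    ultimately have "ipX (x m - u) (x m - u) = 0" by (rule Q_perp_ker)
    then show ?thesis by (simp add: X.ip_self)
  qed
  ultimately show ?thesis
    unfolding arg_min_def by (rule some_equality)
qed

end

section \<open>SINE iterates and the Moore--Penrose inverse\<close>

theorem theorem3p1:
  fixes scaleX :: "'k::real_or_complex \<Rightarrow> 'x::{real_inner, complete_space} \<Rightarrow> 'x"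
    and scaleY :: "'k \<Rightarrow> 'y::{real_inner, complete_space} \<Rightarrow> 'y"
    and ipX :: "'x \<Rightarrow> 'x \<Rightarrow> 'k" and ipY :: "'y \<Rightarrow> 'y \<Rightarrow> 'k"
    and T :: "'x \<Rightarrow> 'y" and \<gamma> :: real and y :: 'y
  assumes "hilbert_space scaleX ipX" and "hilbert_space scaleY ipY"
    and "Vector_Spaces.linear scaleX scaleY T" and "continuous_on UNIV T"
    and "\<not> closed (range T)"
    and "\<gamma> > 0"
    and "y \<in> mp_domain ipY T"
  shows "(\<lambda>n. sine_iterate scaleX ipX ipY T \<gamma> y n) \<longlonglongrightarrow> mp_inverse ipX ipY T y"
proof -
  interpret X: hilbert_space scaleX ipX by (rule assms(1))
  interpret Y: hilbert_space scaleY ipY by (rule assms(2))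
  interpret Tk: Vector_Spaces.linear scaleX scaleY T by (rule assms(3))
  have "linear T"
    by (rule linearI) (simp_all add: Tk.add Tk.scale flip: X.scale_of_real Y.scale_of_real)
  then have T: "bounded_linear T"
    using assms(4) by (rule bounded_linear_if_continuous)
  interpret T: bounded_linear T by (rule T)
  obtain S where S: "bounded_linear S" and adj: "\<And>u v. inner (T u) v = inner u (S v)"
    using bounded_linear_adjoint_exists[OF T] by blast
  interpret S: bounded_linear S by (rule S)
  \<comment> \<open>The real adjoint identity holds for all multiples of \<open>u\<close> over
    \<open>'k\<close> because \<open>T\<close> commutes with scalars, and this is what
    \<open>ip_eqI\<close> requires.\<close>
  have ip_adj: "ipY (T u) v = ipX u (S v)" for u v
    by (rule ip_eqI[OF assms(2,1)]) (simp add: adj flip: Tk.scale)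
  have S_eq: "hilbert_adjoint ipX ipY T = S"
    unfolding hilbert_adjoint_def
  proof (rule the_equality)
    fix S' assume S': "\<forall>u v. ipY (T u) v = ipX u (S' v)"
    have "S' v - S v = 0" for v
      by (rule X.ip_eq_0_all) (simp add: X.ip_diff_right flip: ip_adj S'[rule_format])
    then show "S' = S" by (simp add: fun_eq_iff)
  qed (simp add: ip_adj)
  define B where "B = shift_invert ipX ipY T \<gamma>"
  have bij: "bij (\<lambda>u. u + (1 / \<gamma>) *\<^sub>R S (T u))"
    by (rule normal_shift_bij[OF T adj \<open>\<gamma> > 0\<close>])
  have B_left: "B (u + (1 / \<gamma>) *\<^sub>R S (T u)) = u" for u
    unfolding B_def shift_invert_def S_eq by (rule inv_f_f[OF bij_is_inj[OF bij]])
  have B_right: "B u + (1 / \<gamma>) *\<^sub>R S (T (B u)) = u" for u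
    unfolding B_def shift_invert_def S_eq by (rule surj_f_inv_f[OF bij_is_surj[OF bij]])

  obtain x0 v where y: "y = T x0 + v" and v: "v \<in> orth_compl ipY (range T)"
    using assms(7) unfolding mp_domain_def by blast
  have "ipY (T u) v = 0" for u
    using v by (auto intro!: Y.ip_zero_commute[of v] simp: orth_compl_def)
  then have Sv: "S v = 0"
    by (auto intro: X.ip_eq_0_all simp flip: ip_adj)
  have ker: "subspace {n. T n = 0}" "closed {n. T n = 0}"
    using \<open>linear T\<close> assms(4)
    by (auto simp: subspace_def T.zero T.add T.scale intro: closed_Collect_eq)
  \<comment> \<open>\<open>p\<close> is the orthogonal projection of \<open>x0\<close> onto the
    kernel of \<open>T\<close>; removing it leaves the candidate for the Moore--Penrose
    solution.\<close>
  obtain p where p: "T p = 0" "\<And>n. T n = 0 \<Longrightarrow> inner p n = inner x0 n"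
    using coercive_form_represents[OF bounded_bilinear_inner _ _ ker bounded_linear_inner_right[of x0]]
    by (auto simp: inner_commute power2_norm_eq_inner)
  define z where "z = x0 - p"
  have z_perp: "inner z n = 0" if "T n = 0" for n
    using p(2)[OF that] by (simp add: z_def inner_diff_left)
  have Sy: "S y = S (T z)"
    using p(1) by (simp add: y z_def T.diff S.add Sv)
  \<comment> \<open>Real orthogonality becomes orthogonality over \<open>'k\<close> because the
    kernel of \<open>T\<close> is closed under all scalars.\<close>
  have z_ip_perp: "ipX z n = 0" if "T n = 0" for n
  proof (rule X.ip_zero_commute, rule X.ip_eq_0_if_inner_eq_0)
    show "inner (scaleX a n) z = 0" for a
      using z_perp[of "scaleX a n"] that by (simp add: Tk.scale inner_commute)
  qed
  have z_eq: "mp_inverse ipX ipY T y = z"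
    unfolding mp_inverse_def S_eq
  proof (rule the_equality)
    show "z \<in> orth_compl ipX {n. T n = 0} \<and> S (T z) = S y"
      by (simp add: orth_compl_def z_ip_perp Sy)
    fix w assume w: "w \<in> orth_compl ipX {n. T n = 0} \<and> S (T w) = S y"
    then have "S (T (w - z)) = 0" by (simp add: T.diff S.diff Sy)
    then have "inner (T (w - z)) (T (w - z)) = 0" by (simp add: adj)
    then have "T (w - z) = 0" by simp
    then have "ipX (w - z) (w - z) = 0"
      using w z_ip_perp[of "w - z"] by (simp add: orth_compl_def X.ip_diff_left)
    then show "w = z" by (simp add: X.ip_self)
  qed

  interpret N: shifted_normal_equation T S B \<gamma> z
    by (rule shifted_normal_equation.intro)
      (fact T S adj assms(6) B_left B_right z_perp)+
  have "\<exists>u\<in>N.K m. \<forall>w\<in>N.K m. inner (T (z - u)) (T w) = 0" for m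
    unfolding N.K_def by (rule finite_span_normal_equation[OF \<open>linear T\<close>]) simp
  then have "\<exists>x. \<forall>m. x m \<in> N.K m \<and> (\<forall>w\<in>N.K m. inner (T (z - x m)) (T w) = 0)"
    by (intro choice) blast
  then obtain x where x: "\<And>m. x m \<in> N.K m"
      "\<And>w m. w \<in> N.K m \<Longrightarrow> inner (T (z - x m)) (T w) = 0"
    by blast
  interpret M: hilbert_normal_iterates scaleX scaleY ipX ipY T S B \<gamma> z x
    by unfold_locales (fact x Tk.scale ip_adj)+
  have "sine_iterate scaleX ipX ipY T \<gamma> y m = x m" for m
  proof (cases "m = 0")
    case True
    \<comment> \<open>\<open>K 0\<close> is trivial, so \<open>x 0\<close> agrees with the
      prescribed start \<open>0\<close>.\<close>
    then show ?thesis using x(1)[of 0] by (simp add: sine_iterate_def N.K_0)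
  next
    case False
    have "sine_space scaleX ipX ipY T \<gamma> y m = M.Q m"
      by (simp add: sine_space_def M.Q_def N.krylov_def S_eq Sy flip: B_def)
    then show ?thesis using False M.arg_min_eq[OF Sy, of m] by (simp add: sine_iterate_def)
  qed
  then show ?thesis using M.x_tendsto by (simp add: z_eq)
qed

end
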